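(* Let $\mathcal{C}$ be the set of integer partitions in which, for every positive integer $i$, none of the following occurs as a sub-partition: $i+(i+1)+(i+1)$; $i+i+(i+1)$; $i+(i+2)+(i+2)+(i+2)$; $i+i+i+(i+2)$; $i+i+i+i$. Let $\mathcal{P}_7$ be the set of $\pi\in\mathcal{C}$ in which neither $1+1$ nor $2+2+2$ occurs as a sub-partition, and let $\mathcal{P}_{7a}$ be the set of $\pi\in\mathcal{C}$ all of whose parts are at least $3$. Then, as formal power series in $x,q$, writing $M=i+2j+3k+4l$, $$\sum_{\pi\in\mathcal{P}_7}x^{\ell(\pi)}q^{|\pi|}=\sum_{i,j,k,l\ge 0}(-1)^l\frac{x^{M}q^{\frac{M(M-1)}{2}+2l^2+i+3j+6k+6l}}{(q;q)_i\,(q^2;q^2)_j\,(q^3;q^3)_k\,(q^4;q^4)_l},$$ $$\sum_{\pi\in\mathcal{P}_{7a}}x^{\ell(\pi)}q^{|\pi|}=\sum_{i,j,k,l\ge 0}(-1)^l\frac{x^{M}q^{\frac{M(M-1)}{2}+2l^2+3i+5j+6k+10l}}{(q;q)_i\,(q^2;q^2)_j\,(q^3;q^3)_k\,(q^4;q^4)_l}.$$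
   Context: Partitions are finite weakly increasing sequences of positive integers (the empty partition is included); $\ell(\pi)$ is the number of parts and $|\pi|$ the sum of the parts of $\pi$. A sub-partition of a partition is a contiguous portion of it. For $n\ge 0$, $(a;q)_n=\prod_{0\le t<n}(1-aq^t)$. All identities are identities of formal power series. *)

theory Defs
  imports "HOL-Analysis.Infinite_Sum" "HOL-Computational_Algebra.Formal_Power_Series" "HOL-Library.Sublist"
begin

definition is_partition :: "nat list \<Rightarrow> bool" where
  "is_partition ps \<longleftrightarrow> sorted ps \<and> (\<forall>p\<in>set ps. 0 < p)"

text \<open>In \<^theory>\<open>HOL-Library.Sublist\<close>, \<^const>\<open>sublist\<close> means a contiguous sublist.\<close>

definition C_set :: "nat list set" where
  "C_set = {ps. is_partition ps \<and>
     (\<forall>i\<ge>1. \<not> sublist [i, i + 1, i + 1] ps \<and>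
            \<not> sublist [i, i, i + 1] ps \<and>
            \<not> sublist [i, i + 2, i + 2, i + 2] ps \<and>
            \<not> sublist [i, i, i, i + 2] ps \<and>
            \<not> sublist [i, i, i, i] ps)}"

definition P7 :: "nat list set" where
  "P7 = {ps \<in> C_set. \<not> sublist [1, 1] ps \<and> \<not> sublist [2, 2, 2] ps}"

definition P7a :: "nat list set" where
  "P7a = {ps \<in> C_set. \<forall>p\<in>set ps. 3 \<le> p}"

definition qpoch :: "'a::comm_ring_1 \<Rightarrow> 'a \<Rightarrow> nat \<Rightarrow> 'a" where
  "qpoch a q n = (\<Prod>t<n. 1 - a * q ^ t)"

text \<open>
  Power series in \<open>x\<close> and \<open>q\<close> are power series in \<open>q\<close> over the ring of power series in \<open>x\<close>.
  Infinite sums are taken in the topology of the type \<open>fps\<close>, which is here the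
  \<open>q\<close>-adic one. The order of the variables matters: with \<open>x\<close> as the outer variable, the
  sums over partitions would not converge, since infinitely many partitions have the
  same number of parts.
\<close>

type_synonym xq_series = "rat fps fps"

definition X :: xq_series where "X = fps_const fps_X"

definition Q :: xq_series where "Q = fps_X"

lemma X_Q_nth: "fps_nth (fps_nth (X ^ m * Q ^ n) b) a = (if a = m \<and> b = n then 1 else 0)"
  by (auto simp: X_def Q_def fps_X_power_nth fps_const_power fps_mult_left_const_nth)

text \<open>
  The coefficient ring \<open>rat fps\<close> is not a field, so the library does not provide that
  division in \<^typ>\<open>xq_series\<close> is exact in general; it is exact for the denominators used here.
\<close>

lemma xq_divide_mult_cancel:
  fixes f g :: xq_series
  assumes "fps_nth g 0 = 1"
  shows "f / g * g = f"
proof -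
  have sub: "subdegree g = 0"
    using assms by (intro subdegree_eq_0) auto
  have inv: "inverse (1 :: rat fps) = 1"
    by simp
  have "g * fps_right_inverse g 1 = 1"
    using assms by (intro fps_right_inverse) auto
  then have "g * inverse g = 1"
    by (subst fps_inverse_def) (simp only: assms inv)
  moreover have "f / g = f * inverse g"
    by (simp add: fps_divide_def sub)
  ultimately show ?thesis
    by (simp add: mult.assoc mult.commute)
qed

lemma qpoch_Q_nth_0: "0 < a \<Longrightarrow> fps_nth (qpoch (Q ^ a) (Q ^ b) n) 0 = 1"
  by (induction n) (auto simp: qpoch_def Q_def)

end

(*
  Let A, B and D be the generating functions in x of C, of the members of C that do not begin with
  1+1+1, and of P_7. Removing the parts equal to 1 from the front and lowering all other parts gives
    A(x) = B(x) + x^3 q^3 A(x q^3),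
    B(x) = A(x q) + x q D(x q) + x^2 q^2 B(x q^2),
    D(x) = B(x q) + x q D(x q),
  while P_7a has the generating function A(x q^2). Eliminating B leaves a system for (A, D) that has
  only one solution with A(0) = 1.

  On the other side, the linear map x^M -> q^(M (M - 1) / 2) x^M sends the infinite products
    K(x) = (x^4 q^4; q^4) / ((x q; q) (x^2 q; q^2) (x^3; q^3)),
    H(x) = (x^4 q^8; q^4) / ((x q; q) (x^2 q^3; q^2) (x^3 q^6; q^3))
  to quadruple sums, by Euler's expansions. The products satisfy H(x) = (1 + x q + x^2 q^2) K(x q) and
    (1 - x q) (1 - x^2 q^3) H(x) = (1 + x q^2) (1 + x^2 q^4) K(x q^2),
  and these two relations are mapped to equations that imply the system for (A, D). Hence D is the
  image of H, and A(x q^2) is the image of K(x q^2).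
*)

theory Submission
  imports Defs
begin

section \<open>Power series in \<open>x\<close> over power series in \<open>q\<close>\<close>

text \<open>
  From here on the variables are nested the other way round: \<open>x\<close> is the outer variable
  \<^term>\<open>fps_X\<close> and \<open>q\<close> the inner one. Then \<open>qshift\<close> is \<open>x \<mapsto> x q\<close>.
\<close>

definition qvar :: "rat fps fps" where
  "qvar = fps_const fps_X"

definition qshift :: "rat fps fps \<Rightarrow> rat fps fps" where
  "qshift f = Abs_fps (\<lambda>n. fps_X ^ n * fps_nth f n)"

definition triangular :: "rat fps fps \<Rightarrow> rat fps fps" where
  "triangular f = Abs_fps (\<lambda>n. fps_X ^ (n * (n - 1) div 2) * fps_nth f n)"

lemma qvar_power: "qvar ^ n = fps_const (fps_X ^ n)"
  by (simp add: qvar_def fps_const_power)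

lemma qvar_mult_nth [simp]: "fps_nth (qvar * f) n = fps_X * fps_nth f n"
  by (simp add: qvar_def)

lemma qvar_power_mult_nth [simp]: "fps_nth (qvar ^ k * f) n = fps_X ^ k * fps_nth f n"
  by (simp add: qvar_power)

lemma qshift_nth [simp]: "fps_nth (qshift f) n = fps_X ^ n * fps_nth f n"
  by (simp add: qshift_def)

lemma triangular_nth [simp]:
  "fps_nth (triangular f) n = fps_X ^ (n * (n - 1) div 2) * fps_nth f n"
  by (simp add: triangular_def)

lemma qshift_add: "qshift (f + g) = qshift f + qshift g"
  by (rule fps_ext) (simp add: distrib_left)

lemma qshift_diff: "qshift (f - g) = qshift f - qshift g"
  by (rule fps_ext) (simp add: right_diff_distrib)

lemma qshift_mult: "qshift (f * g) = qshift f * qshift g"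
proof (rule fps_ext)
  fix n
  have "fps_X ^ n * (\<Sum>i=0..n. fps_nth f i * fps_nth g (n - i)) =
      (\<Sum>i=0..n. (fps_X ^ i * fps_nth f i) * (fps_X ^ (n - i) * fps_nth g (n - i)))"
    unfolding sum_distrib_left
  proof (rule sum.cong)
    fix i assume "i \<in> {0..n}"
    then have "(fps_X :: rat fps) ^ n = fps_X ^ i * fps_X ^ (n - i)"
      by (simp flip: power_add)
    then show "fps_X ^ n * (fps_nth f i * fps_nth g (n - i)) =
        (fps_X ^ i * fps_nth f i) * (fps_X ^ (n - i) * fps_nth g (n - i))"
      by (simp add: ac_simps)
  qed simp
  then show "fps_nth (qshift (f * g)) n = fps_nth (qshift f * qshift g) n"
    by (simp add: fps_mult_nth)
qed

lemma qshift_1: "qshift 1 = 1"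
  by (rule fps_ext) simp

lemma qshift_qvar: "qshift qvar = qvar"
  by (rule fps_ext) (simp add: qvar_def)

lemma qshift_X: "qshift fps_X = qvar * fps_X"
  by (rule fps_ext) (auto simp: fps_X_def)

lemma qshift_power: "qshift (f ^ n) = qshift f ^ n"
  by (induction n) (simp_all add: qshift_1 qshift_mult)

lemmas qshift_simps =
  qshift_add qshift_diff qshift_mult qshift_1 qshift_qvar qshift_X qshift_power

text \<open>The coefficient of x^n is multiplied by q^n, which can be cancelled. This allows an
  equation to be proved after the substitution x -> x q and then shifted back.\<close>

lemma qshift_inject: "qshift f = qshift g \<longleftrightarrow> f = g"
  by (auto simp: fps_eq_iff[of "qshift f"] intro: fps_ext)

lemma triangular_add: "triangular (f + g) = triangular f + triangular g"
  by (rule fps_ext) (simp add: distrib_left)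

lemma triangular_diff: "triangular (f - g) = triangular f - triangular g"
  by (rule fps_ext) (simp add: right_diff_distrib)

lemma triangular_qvar_mult: "triangular (qvar * f) = qvar * triangular f"
  by (rule fps_ext) (simp add: ac_simps)

lemma triangular_qshift: "triangular (qshift f) = qshift (triangular f)"
  by (rule fps_ext) (simp add: ac_simps)

text \<open>From m to m + 1 the exponent m (m - 1) / 2 grows by m, and the extra factor q^m is a
  shift. So every factor x in a relation between products turns into x followed by one more
  \<open>qshift\<close>.\<close>

lemma triangular_X_mult: "triangular (fps_X * f) = fps_X * qshift (triangular f)"
proof (rule fps_ext)
  fix n
  show "fps_nth (triangular (fps_X * f)) n = fps_nth (fps_X * qshift (triangular f)) n"
  proof (cases n)
    case (Suc m)
    have "Suc m * m div 2 = m + m * (m - 1) div 2"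
      by (cases m) (auto simp: algebra_simps)
    then show ?thesis
      by (simp add: Suc power_add mult.assoc)
  qed simp
qed

lemmas triangular_simps =
  triangular_add triangular_diff triangular_qvar_mult triangular_qshift triangular_X_mult

text \<open>A series in x^r, given by its coefficients \<open>u j\<close> at x^(r j). The Euler
  expansions can thus be handled through their coefficient sequences alone.\<close>

definition spread :: "nat \<Rightarrow> (nat \<Rightarrow> rat fps) \<Rightarrow> rat fps fps" where
  "spread r u = Abs_fps (\<lambda>m. if r dvd m then u (m div r) else 0)"

lemma spread_nth: "fps_nth (spread r u) m = (if r dvd m then u (m div r) else 0)"
  by (simp add: spread_def)

lemma qshift_spread: "qshift (spread r u) = spread r (\<lambda>j. fps_X ^ (r * j) * u j)"
  by (rule fps_ext) (simp add: spread_nth)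

lemma spread_add: "spread r u + spread r v = spread r (\<lambda>j. u j + v j)"
  by (rule fps_ext) (simp add: spread_nth)

lemma spread_diff: "spread r u - spread r v = spread r (\<lambda>j. u j - v j)"
  by (rule fps_ext) (simp add: spread_nth)

lemma spread_qvar_power: "qvar ^ c * spread r u = spread r (\<lambda>j. fps_X ^ c * u j)"
  by (rule fps_ext) (simp add: spread_nth)

lemma spread_X_power:
  assumes "0 < r"
  shows "fps_X ^ r * spread r u = spread r (\<lambda>j. if j = 0 then 0 else u (j - 1))"
proof (rule fps_ext)
  fix m
  show "fps_nth (fps_X ^ r * spread r u) m =
      fps_nth (spread r (\<lambda>j. if j = 0 then 0 else u (j - 1))) m"
  proof (cases "m < r")
    case True
    then show ?thesis
      by (auto simp: fps_X_power_mult_nth spread_nth)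
  next
    case False
    then have "r dvd m - r \<longleftrightarrow> r dvd m" "m div r \<noteq> 0" "(m - r) div r = m div r - 1"
      using assms by (auto simp: dvd_minus_self div_eq_0_iff le_div_geq)
    with False show ?thesis
      by (simp add: fps_X_power_mult_nth spread_nth)
  qed
qed

section \<open>The infinite products\<close>

definition rqpoch :: "nat \<Rightarrow> nat \<Rightarrow> rat fps" where
  "rqpoch r n = qpoch (fps_X ^ r) (fps_X ^ r) n"

lemma rqpoch_0: "rqpoch r 0 = 1"
  by (simp add: rqpoch_def qpoch_def)

lemma rqpoch_Suc: "rqpoch r (Suc n) = rqpoch r n * (1 - fps_X ^ (r * Suc n))"
  by (simp add: rqpoch_def qpoch_def power_add flip: power_mult)

lemma rqpoch_nth_0: "0 < r \<Longrightarrow> fps_nth (rqpoch r n) 0 = 1"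
  by (induction n) (simp_all add: rqpoch_0 rqpoch_Suc)

lemma inverse_rqpoch_mult: "0 < r \<Longrightarrow> inverse (rqpoch r n) * rqpoch r n = 1"
  by (rule inverse_mult_eq_1) (simp add: rqpoch_nth_0)

text \<open>The numerator is the last factor of \<open>rqpoch r (Suc n)\<close>. This cancellation
  is the source of the difference equations of both Euler series.\<close>

lemma inverse_rqpoch_Suc:
  assumes "0 < r"
  shows "(1 - fps_X ^ (r * Suc n)) * inverse (rqpoch r (Suc n)) = inverse (rqpoch r n)"
proof -
  have "(1 - fps_X ^ (r * Suc n)) * inverse (rqpoch r (Suc n)) =
      inverse (rqpoch r n) * rqpoch r n * ((1 - fps_X ^ (r * Suc n)) * inverse (rqpoch r (Suc n)))"
    using assms by (simp add: inverse_rqpoch_mult)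
  also have "\<dots> = inverse (rqpoch r n) * (inverse (rqpoch r (Suc n)) * rqpoch r (Suc n))"
    unfolding rqpoch_Suc by (simp only: ac_simps)
  also have "\<dots> = inverse (rqpoch r n)"
    using assms by (simp add: inverse_rqpoch_mult)
  finally show ?thesis .
qed

text \<open>By Euler's identities, \<open>euler_inv r c\<close> is \<open>1 / (x\<^sup>r q\<^sup>c; q\<^sup>r)\<^sub>\<infinity>\<close> and \<open>euler_prod r c\<close>
  is \<open>(x\<^sup>r q\<^sup>c; q\<^sup>r)\<^sub>\<infinity>\<close>; only their first-order \<open>q\<close>-difference equations are needed.\<close>

definition euler_inv :: "nat \<Rightarrow> nat \<Rightarrow> rat fps fps" where
  "euler_inv r c = spread r (\<lambda>j. fps_X ^ (c * j) * inverse (rqpoch r j))"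

definition euler_prod :: "nat \<Rightarrow> nat \<Rightarrow> rat fps fps" where
  "euler_prod r c = spread r (\<lambda>j. (- 1) ^ j * fps_X ^ (r * (j * (j - 1) div 2) + c * j) * inverse (rqpoch r j))"

lemma qshift_euler_inv: "qshift (euler_inv r c) = euler_inv r (c + r)"
  unfolding euler_inv_def qshift_spread
  by (rule arg_cong[of _ _ "spread r"]) (simp add: fun_eq_iff power_add algebra_simps)

lemma qshift_euler_prod: "qshift (euler_prod r c) = euler_prod r (c + r)"
  unfolding euler_prod_def qshift_spread
  by (rule arg_cong[of _ _ "spread r"]) (simp add: fun_eq_iff power_add algebra_simps)

text \<open>With F = \<open>euler_inv r c\<close>, the coefficient of x^(r j) in F(x) - F(x q)
  carries the factor 1 - q^(r j). It cancels against the denominator and leaves q^c x^r F(x).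
  Keeping \<open>d\<close> separate from \<open>c + r\<close> lets numerals be supplied for
  both.\<close>

lemma euler_inv_step:
  assumes "0 < r" "d = c + r"
  shows "euler_inv r d = (1 - qvar ^ c * fps_X ^ r) * euler_inv r c"
proof -
  have "euler_inv r c - qshift (euler_inv r c) = qvar ^ c * (fps_X ^ r * euler_inv r c)"
    unfolding euler_inv_def qshift_spread spread_diff spread_X_power[OF assms(1)] spread_qvar_power
  proof (rule arg_cong[of _ _ "spread r"], rule ext)
    fix j
    show "fps_X ^ (c * j) * inverse (rqpoch r j) -
        fps_X ^ (r * j) * (fps_X ^ (c * j) * inverse (rqpoch r j)) =
        fps_X ^ c * (if j = 0 then 0 else fps_X ^ (c * (j - 1)) * inverse (rqpoch r (j - 1)))"
    proof (cases j)
      case (Suc i)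
      show ?thesis
        unfolding Suc using inverse_rqpoch_Suc[OF assms(1), of i, symmetric]
        by (simp add: power_add right_diff_distrib left_diff_distrib ac_simps)
    qed simp
  qed
  then show ?thesis
    by (simp add: assms(2) qshift_euler_inv algebra_simps)
qed

text \<open>The same cancellation applies, but from j - 1 to j the quadratic exponent grows by r (j
  - 1). Hence the series multiplied by -q^c x^r is the shifted one, F(x q).\<close>

lemma euler_prod_step:
  assumes "0 < r" "d = c + r"
  shows "euler_prod r c = (1 - qvar ^ c * fps_X ^ r) * euler_prod r d"
proof -
  have "euler_prod r c - qshift (euler_prod r c) + qvar ^ c * (fps_X ^ r * euler_prod r (c + r)) = spread r (\<lambda>j. 0)"
    unfolding euler_prod_def qshift_spread spread_diff spread_X_power[OF assms(1)] spread_qvar_power spread_add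
  proof (rule arg_cong[of _ _ "spread r"], rule ext)
    fix j
    let ?u = "\<lambda>j. (- 1) ^ j * fps_X ^ (r * (j * (j - 1) div 2) + c * j) * inverse (rqpoch r j)"
    let ?v = "\<lambda>j. (- 1) ^ j * fps_X ^ (r * (j * (j - 1) div 2) + (c + r) * j) * inverse (rqpoch r j)"
    show "?u j - fps_X ^ (r * j) * ?u j + fps_X ^ c * (if j = 0 then 0 else ?v (j - 1)) = 0"
    proof (cases j)
      case (Suc i)
      have "Suc i * i div 2 = i + i * (i - 1) div 2"
        by (cases i) (auto simp: algebra_simps)
      then have "?u (Suc i) = - (fps_X ^ c * ((- 1) ^ i * fps_X ^ (r * (i * (i - 1) div 2) + (c + r) * i))) *
          inverse (rqpoch r (Suc i))"
        by (simp add: power_add algebra_simps)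
      then have "?u (Suc i) - fps_X ^ (r * Suc i) * ?u (Suc i) = - (fps_X ^ c * ((- 1) ^ i *
            fps_X ^ (r * (i * (i - 1) div 2) + (c + r) * i))) *
          ((1 - fps_X ^ (r * Suc i)) * inverse (rqpoch r (Suc i)))"
        by (simp only: left_diff_distrib right_diff_distrib mult_1 ac_simps)
      then show ?thesis
        unfolding Suc inverse_rqpoch_Suc[OF assms(1)] by (simp add: mult.assoc)
    qed simp
  qed
  also have "spread r (\<lambda>j. 0) = 0"
    by (rule fps_ext) (simp add: spread_nth)
  finally show ?thesis
    by (simp add: assms(2) qshift_euler_prod algebra_simps)
qed

section \<open>The q-difference system and its uniqueness\<close>

definition qdiff_system :: "rat fps fps \<Rightarrow> rat fps fps \<Rightarrow> bool" where
  "qdiff_system A D \<longleftrightarrow> fps_nth A 0 = 1 \<and>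
     D = qvar * (fps_X * qshift D) + qshift A
       - qvar ^ 6 * (fps_X ^ 3 * qshift (qshift (qshift (qshift A)))) \<and>
     A = qshift A + qvar * (fps_X * qshift D)
       + qvar ^ 2 * (fps_X ^ 2 * qshift (qshift A))
       - qvar ^ 11 * (fps_X ^ 5 * qshift (qshift (qshift (qshift (qshift A)))))
       + qvar ^ 3 * (fps_X ^ 3 * qshift (qshift (qshift A)))"

text \<open>For n > 0, every term on the right of the A-equation except A(x q) has a factor x, so (1
  - q^n) times the n-th coefficient of A is fixed by earlier coefficients. The D-equation then gives
  the n-th coefficient of D.\<close>

lemma qdiff_system_unique:
  assumes "qdiff_system A D" "qdiff_system A' D'"
  shows "A = A'" "D = D'"
proof -
  have sys: "fps_nth A 0 = 1"
    "D = qvar * (fps_X * qshift D) + qshift A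
       - qvar ^ 6 * (fps_X ^ 3 * qshift (qshift (qshift (qshift A))))"
    "A = qshift A + qvar * (fps_X * qshift D)
       + qvar ^ 2 * (fps_X ^ 2 * qshift (qshift A))
       - qvar ^ 11 * (fps_X ^ 5 * qshift (qshift (qshift (qshift (qshift A)))))
       + qvar ^ 3 * (fps_X ^ 3 * qshift (qshift (qshift A)))"
    if "qdiff_system A D" for A D
    using that by (auto simp: qdiff_system_def)
  have "fps_nth A n = fps_nth A' n \<and> fps_nth D n = fps_nth D' n" for n
  proof (induction n rule: less_induct)
    case (less n)
    have A: "fps_nth A n = fps_nth A' n"
    proof (cases "n = 0")
      case True
      then show ?thesis
        using sys(1)[OF assms(1)] sys(1)[OF assms(2)] by simp
    next
      case False
      have "fps_nth (fps_X ^ k * f) n = fps_nth (fps_X ^ k * g) n"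
        if "0 < k" "\<And>m. m < n \<Longrightarrow> fps_nth f m = fps_nth g m" for k and f g :: "rat fps fps"
        using that by (auto simp: fps_X_power_mult_nth)
      from this[of 1] this
      have "fps_nth A n - fps_X ^ n * fps_nth A n = fps_nth A' n - fps_X ^ n * fps_nth A' n"
        using less.IH
        apply (subst (1) sys(3)[OF assms(1)])
        apply (subst (1) sys(3)[OF assms(2)])
        apply (simp add: fps_X_power_mult_nth)
        done
      then have "(1 - fps_X ^ n) * (fps_nth A n - fps_nth A' n) = 0"
        by (simp add: algebra_simps)
      \<comment> \<open>As n > 0, the factor has constant coefficient 1 and may be
        cancelled.\<close>
      moreover have "fps_nth (1 - fps_X ^ n) 0 \<noteq> (0 :: rat)"
        using False by simp
      then have "1 - fps_X ^ n \<noteq> (0 :: rat fps)"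
        by (metis fps_zero_nth)
      ultimately show ?thesis
        by simp
    qed
    moreover have "fps_nth D n = fps_nth D' n"
      apply (subst (1) sys(2)[OF assms(1)])
      apply (subst (1) sys(2)[OF assms(2)])
      using less.IH A by (simp add: fps_X_power_mult_nth)
    ultimately show ?case ..
  qed
  then show "A = A'" "D = D'"
    by (auto intro: fps_ext)
qed

text \<open>\<open>product_A\<close> and \<open>product_D\<close> are the products K and H, written
  through their Euler expansions.\<close>

definition product_A :: "rat fps fps" where
  "product_A = euler_inv 1 1 * (euler_inv 2 1 * (euler_inv 3 0 * euler_prod 4 4))"

definition product_D :: "rat fps fps" where
  "product_D = euler_inv 1 1 * (euler_inv 2 3 * (euler_inv 3 6 * euler_prod 4 8))"

lemma product_relations:
  shows "product_D = (1 + qvar * fps_X + qvar ^ 2 * fps_X ^ 2) * qshift product_A" (is ?r1)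
    and "(1 - qvar * fps_X) * (1 - qvar ^ 3 * fps_X ^ 2) * product_D =
      (1 + qvar ^ 2 * fps_X) * (1 + qvar ^ 4 * fps_X ^ 2) * qshift (qshift product_A)" (is ?r2)
proof -
  \<comment> \<open>Common factors of H(x), K(x q) and K(x q^2): the other Euler factors arise from
    these by multiplication with polynomials.\<close>
  define e1 e2 e3 p where "e1 = euler_inv 1 1" "e2 = euler_inv 2 3" "e3 = euler_inv 3 3"
    "p = euler_prod 4 12"
  have e: "euler_inv 1 2 = (1 - qvar * fps_X) * e1"
    "euler_inv 1 3 = (1 - qvar ^ 2 * fps_X) * euler_inv 1 2"
    "euler_inv 2 5 = (1 - qvar ^ 3 * fps_X ^ 2) * e2"
    "euler_inv 3 6 = (1 - qvar ^ 3 * fps_X ^ 3) * e3"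
    "euler_prod 4 8 = (1 - qvar ^ 8 * fps_X ^ 4) * p"
    using euler_inv_step[of 1 2 1] euler_inv_step[of 1 3 2] euler_inv_step[of 2 5 3]
      euler_inv_step[of 3 6 3] euler_prod_step[of 4 12 8]
    by (simp_all add: e1_e2_e3_p_def)
  have s1: "qshift product_A = euler_inv 1 2 * (e2 * (e3 * euler_prod 4 8))"
    by (simp add: product_A_def qshift_mult qshift_euler_inv qshift_euler_prod e1_e2_e3_p_def
        numeral_2_eq_2 numeral_3_eq_3)
  have s2: "qshift (qshift product_A) =
      euler_inv 1 3 * (euler_inv 2 5 * (euler_inv 3 6 * p))"
    by (simp add: product_A_def qshift_mult qshift_euler_inv qshift_euler_prod e1_e2_e3_p_def
        eval_nat_numeral)
  have d: "product_D = e1 * (e2 * (euler_inv 3 6 * euler_prod 4 8))"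
    by (simp add: product_D_def e1_e2_e3_p_def)
  \<comment> \<open>Apart from common factors this is (1 + t + t^2)(1 - t) = 1 - t^3 with t = x
    q.\<close>
  show ?r1
    unfolding d s1 e by algebra
  \<comment> \<open>Here it is (1 + t)(1 + t^2)(1 - t) = 1 - t^4 with t = x q^2.\<close>
  show ?r2
    unfolding d s2 e by algebra
qed

lemma qdiff_system_product: "qdiff_system (triangular product_A) (triangular product_D)"
proof -
  let ?x = "fps_X :: rat fps fps"
  let ?A = "triangular product_A" and ?D = "triangular product_D"
  let ?s = qshift
  have D: "?D = ?s ?A + qvar * (?x * ?s (?s ?A)) + qvar ^ 3 * (?x ^ 2 * ?s (?s (?s ?A)))"
  proof -
    \<comment> \<open>Powers of x and q are written as nested products, so that
      \<open>triangular\<close> can be moved past one factor at a time.\<close>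
    have "product_D = ?s product_A + qvar * (?x * ?s product_A) +
        qvar * (qvar * (?x * (?x * ?s product_A)))"
      using product_relations(1) by (simp add: algebra_simps power2_eq_square)
    from arg_cong[OF this, of triangular] show ?thesis
      by (simp add: triangular_simps qshift_simps algebra_simps power2_eq_square power3_eq_cube)
  qed
  \<comment> \<open>The sum telescopes: the last two terms of D(x) are the first two of x q D(x
    q).\<close>
  have D': "?D - qvar * (?x * ?s ?D) = ?s ?A - qvar ^ 6 * (?x ^ 3 * ?s (?s (?s (?s ?A))))"
    by (subst (1 2) D) (simp add: qshift_simps, algebra)
  have "product_D - qvar * (?x * product_D) - qvar * (qvar * (qvar * (?x * (?x * product_D)))) +
      qvar * (qvar * (qvar * (qvar * (?x * (?x * (?x * product_D)))))) =
      ?s (?s product_A) + qvar * (qvar * (?x * ?s (?s product_A))) +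
      qvar * (qvar * (qvar * (qvar * (?x * (?x * ?s (?s product_A)))))) +
      qvar * (qvar * (qvar * (qvar * (qvar * (qvar * (?x * (?x * (?x * ?s (?s product_A)))))))))"
    using product_relations(2) by algebra
  from arg_cong[OF this, of triangular]
  have E: "?D - qvar * (?x * ?s ?D) - qvar ^ 4 * (?x ^ 2 * ?s (?s ?D)) +
      qvar ^ 7 * (?x ^ 3 * ?s (?s (?s ?D))) =
      ?s (?s ?A) + qvar ^ 2 * (?x * ?s (?s (?s ?A))) + qvar ^ 5 * (?x ^ 2 * ?s (?s (?s (?s ?A))))
      + qvar ^ 9 * (?x ^ 3 * ?s (?s (?s (?s (?s ?A)))))"
    by (simp add: triangular_simps qshift_simps, algebra)
  \<comment> \<open>The relations involve A only from A(x q) on, so the A-equation is proved in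
    shifted form. By \<open>D\<close> and the shifted \<open>D'\<close>, the right side of
    \<open>E\<close> is D(x q) + q^9 x^3 A(x q^5) = A(x q^2) + q^2 x D(x q^2). The second shift of
    \<open>D'\<close>, times q^4 x^2, replaces the last two D-terms on the left, and
    \<open>D'\<close> itself the first two.\<close>
  have "?s ?A = ?s (?s ?A + qvar * (?x * ?s ?D)
       + qvar ^ 2 * (?x ^ 2 * ?s (?s ?A))
       - qvar ^ 11 * (?x ^ 5 * ?s (?s (?s (?s (?s ?A)))))
       + qvar ^ 3 * (?x ^ 3 * ?s (?s (?s ?A))))"
    using E D' arg_cong[OF D, of ?s] arg_cong[OF D', of ?s] arg_cong[OF arg_cong[OF D', of ?s], of ?s]
    unfolding qshift_simps by algebra
  then have "?A = ?s ?A + qvar * (?x * ?s ?D)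
       + qvar ^ 2 * (?x ^ 2 * ?s (?s ?A))
       - qvar ^ 11 * (?x ^ 5 * ?s (?s (?s (?s (?s ?A)))))
       + qvar ^ 3 * (?x ^ 3 * ?s (?s (?s ?A)))"
    unfolding qshift_inject .
  moreover have "fps_nth ?A 0 = 1"
    by (simp add: product_A_def euler_inv_def euler_prod_def spread_nth rqpoch_0)
  ultimately show ?thesis
    unfolding qdiff_system_def using D' by (simp add: algebra_simps)
qed

section \<open>Generating functions of the partition classes\<close>

text \<open>Length and sum together leave only finitely many lists, so with x as the outer variable
  all coefficients are finite counts.\<close>

definition list_gf :: "nat list set \<Rightarrow> rat fps fps" where
  "list_gf S = Abs_fps (\<lambda>n. Abs_fps (\<lambda>N. of_nat (card {ps \<in> S. length ps = n \<and> sum_list ps = N})))"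

lemma list_gf_nth:
  "fps_nth (fps_nth (list_gf S) n) N = of_nat (card {ps \<in> S. length ps = n \<and> sum_list ps = N})"
  by (simp add: list_gf_def)

lemma finite_length_sum: "finite {ps \<in> S. length ps = n \<and> sum_list ps = (N :: nat)}"
proof (rule finite_subset)
  show "{ps \<in> S. length ps = n \<and> sum_list ps = N} \<subseteq> {ps. set ps \<subseteq> {..N} \<and> length ps = n}"
    using member_le_sum_list by auto
  show "finite {ps. set ps \<subseteq> {..N} \<and> length ps = n}"
    by (rule finite_lists_length_eq) simp
qed

lemma list_gf_Un:
  assumes "S \<inter> T = {}"
  shows "list_gf (S \<union> T) = list_gf S + list_gf T"
proof (rule fps_ext, rule fps_ext)
  fix n N
  have "{ps \<in> S \<union> T. length ps = n \<and> sum_list ps = N} =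
      {ps \<in> S. length ps = n \<and> sum_list ps = N} \<union> {ps \<in> T. length ps = n \<and> sum_list ps = N}"
    by auto
  moreover have "{ps \<in> S. length ps = n \<and> sum_list ps = N} \<inter>
      {ps \<in> T. length ps = n \<and> sum_list ps = N} = {}"
    using assms by auto
  ultimately show "fps_nth (fps_nth (list_gf (S \<union> T)) n) N = fps_nth (fps_nth (list_gf S + list_gf T) n) N"
    by (simp add: list_gf_nth card_Un_disjoint finite_length_sum)
qed

lemma sum_list_map_Suc: "sum_list (map Suc ps) = length ps + sum_list ps"
  by (induction ps) auto

text \<open>Raising all entries by one adds the length to the sum, which is the substitution x -> x
  q.\<close>

lemma list_gf_map_Suc: "list_gf (map Suc ` S) = qshift (list_gf S)"
proof (rule fps_ext, rule fps_ext)
  fix n N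
  have "{ps \<in> map Suc ` S. length ps = n \<and> sum_list ps = N} =
      map Suc ` {ps \<in> S. length ps = n \<and> n + sum_list ps = N}"
    by (auto simp: sum_list_map_Suc)
  then have "card {ps \<in> map Suc ` S. length ps = n \<and> sum_list ps = N} =
      card {ps \<in> S. length ps = n \<and> n + sum_list ps = N}"
    by (simp add: card_image inj_on_def inj_map_eq_map)
  also have "{ps \<in> S. length ps = n \<and> n + sum_list ps = N} =
      (if N < n then {} else {ps \<in> S. length ps = n \<and> sum_list ps = N - n})"
    by auto
  finally show "fps_nth (fps_nth (list_gf (map Suc ` S)) n) N = fps_nth (fps_nth (qshift (list_gf S)) n) N"
    by (simp add: list_gf_nth fps_X_power_mult_nth)
qed

lemma list_gf_Cons_1: "list_gf ((#) 1 ` S) = qvar * (fps_X * list_gf S)"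
proof (rule fps_ext, rule fps_ext)
  fix n N
  have "{ps \<in> (#) 1 ` S. length ps = n \<and> sum_list ps = N} =
      (#) 1 ` {ps \<in> S. Suc (length ps) = n \<and> Suc (sum_list ps) = N}"
    by auto
  then have "card {ps \<in> (#) 1 ` S. length ps = n \<and> sum_list ps = N} =
      card {ps \<in> S. Suc (length ps) = n \<and> Suc (sum_list ps) = N}"
    by (simp add: card_image)
  also have "{ps \<in> S. Suc (length ps) = n \<and> Suc (sum_list ps) = N} =
      (if n = 0 \<or> N = 0 then {} else {ps \<in> S. length ps = n - 1 \<and> sum_list ps = N - 1})"
    by auto
  finally show "fps_nth (fps_nth (list_gf ((#) 1 ` S)) n) N =
      fps_nth (fps_nth (qvar * (fps_X * list_gf S)) n) N"
    by (simp add: list_gf_nth)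
qed

section \<open>Forbidden sub-partitions as conditions on the first parts\<close>

lemma Cons_prefix_iff: "prefix (x # xs) ys \<longleftrightarrow> (\<exists>zs. ys = x # zs \<and> prefix xs zs)"
  by (cases ys) auto

lemma prefix_map_Suc: "prefix (map Suc xs) (map Suc ys) \<longleftrightarrow> prefix xs ys"
  by (induction xs arbitrary: ys) (auto simp: Cons_prefix_iff map_eq_Cons_conv)

text \<open>In a sorted list, all copies of a lower bound \<open>m\<close> stand at the
  front.\<close>

lemma sublist_replicate_least:
  assumes "sorted ps" "\<forall>p\<in>set ps. m \<le> p" "sublist (replicate k m) ps"
  shows "prefix (replicate k m) ps"
  using assms
proof (induction ps)
  case (Cons a ps)
  show ?case
  proof (cases "prefix (replicate k m) (a # ps)")
    case False
    with Cons have *: "prefix (replicate k m) ps"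
      by (simp add: sublist_Cons_right)
    show ?thesis
    proof (cases k)
      case (Suc j)
      with * have "m \<in> set ps" "prefix (replicate j m) ps"
        using append_prefixD[of "replicate j m" "[m]" ps]
        by (auto simp: Cons_prefix_iff replicate_append_same)
      with Cons.prems Suc show ?thesis
        by auto
    qed simp
  qed
qed simp

lemma Nil_in_C_set: "[] \<in> C_set"
  by (simp add: C_set_def is_partition_def)

text \<open>A forbidden sub-partition either begins with \<open>a\<close>, which fixes i =
  \<open>a\<close> and makes its tail a prefix of \<open>ps\<close>, or lies within
  \<open>ps\<close>.\<close>

lemma Cons_in_C_set_iff:
  "a # ps \<in> C_set \<longleftrightarrow> 0 < a \<and> (\<forall>p\<in>set ps. a \<le> p) \<and> ps \<in> C_set \<and>
     \<not> prefix [a + 1, a + 1] ps \<and> \<not> prefix [a, a + 1] ps \<and> \<not> prefix [a + 2, a + 2, a + 2] ps \<and>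
     \<not> prefix [a, a, a + 2] ps \<and> \<not> prefix [a, a, a] ps"
proof -
  have split: "(\<forall>i\<ge>1. \<not> sublist (i # f i) (a # ps)) \<longleftrightarrow>
      (0 < a \<longrightarrow> \<not> prefix (f a) ps) \<and> (\<forall>i\<ge>1. \<not> sublist (i # f i) ps)" for f
    by (auto simp: sublist_Cons_right Suc_le_eq)
  have "is_partition (a # ps) \<longleftrightarrow> 0 < a \<and> (\<forall>p\<in>set ps. a \<le> p) \<and> is_partition ps"
    by (auto simp: is_partition_def)
  then show ?thesis
    unfolding C_set_def mem_Collect_eq imp_conjR all_conj_distrib
      split[of "\<lambda>i. [i + 1, i + 1]"] split[of "\<lambda>i. [i, i + 1]"]
      split[of "\<lambda>i. [i + 2, i + 2, i + 2]"] split[of "\<lambda>i. [i, i, i + 2]"]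
      split[of "\<lambda>i. [i, i, i]"]
    by argo
qed

text \<open>The five families of patterns are invariant under i -> i + 1. An entry 0 must be
  excluded because it would turn into the admissible part 1.\<close>

lemma map_Suc_in_C_set_iff:
  assumes "0 \<notin> set ps"
  shows "map Suc ps \<in> C_set \<longleftrightarrow> ps \<in> C_set"
  using assms
proof (induction ps)
  case (Cons a ps)
  have "prefix [Suc x, Suc y] (map Suc ps) \<longleftrightarrow> prefix [x, y] ps"
    "prefix [Suc x, Suc y, Suc z] (map Suc ps) \<longleftrightarrow> prefix [x, y, z] ps" for x y z
    using prefix_map_Suc[of "[x, y]"] prefix_map_Suc[of "[x, y, z]"] by simp_all
  with Cons show ?case
    by (simp add: Cons_in_C_set_iff)
qed (simp add: Nil_in_C_set)

lemma C_set_sorted: "ps \<in> C_set \<Longrightarrow> sorted ps"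
  by (simp add: C_set_def is_partition_def)

lemma C_set_positive: "ps \<in> C_set \<Longrightarrow> 0 \<notin> set ps"
  by (auto simp: C_set_def is_partition_def)

text \<open>A block 1+1 can only stand at the front. So can 2+2+2, unless a 1 precedes it; but
  without 1+1 there is just one such 1, and then 1+2+2 occurs, which is forbidden in C.\<close>

lemma P7_iff_prefix:
  "ps \<in> P7 \<longleftrightarrow> ps \<in> C_set \<and> \<not> prefix [1, 1] ps \<and> \<not> prefix [2, 2, 2] ps"
proof
  assume "ps \<in> C_set \<and> \<not> prefix [1, 1] ps \<and> \<not> prefix [2, 2, 2] ps"
  then have ps: "ps \<in> C_set" "\<not> prefix [1, 1] ps" "\<not> prefix [2, 2, 2] ps"
    by auto
  have "\<not> sublist [1, 1] ps"
    using sublist_replicate_least[of ps 1 2] C_set_sorted[OF ps(1)] C_set_positive[OF ps(1)] ps(2)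
    by (auto simp: numeral_2_eq_2 Suc_le_eq intro: gr0I)
  moreover have "\<not> sublist [2, 2, 2] ps"
  proof
    assume sub: "sublist [2, 2, 2] ps"
    show False
    proof (cases "\<forall>p\<in>set ps. 2 \<le> p")
      case True
      then show ?thesis
        using sublist_replicate_least[of ps 2 3] C_set_sorted[OF ps(1)] ps(3) sub
        by (simp add: numeral_3_eq_3)
    next
      case False
      then obtain a r where [simp]: "ps = a # r"
        by (cases ps) auto
      have [simp]: "a = 1"
        using False ps(1) by (auto simp: Cons_in_C_set_iff)
      have r: "r \<in> C_set" "\<not> prefix [2, 2] r" "\<not> prefix [1] r"
        using ps by (auto simp: Cons_in_C_set_iff numeral_2_eq_2)
      have "\<forall>p\<in>set r. 2 \<le> p"
      proof (cases r)
        case (Cons b s)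
        then have "2 \<le> b"
          using r by (auto simp: Cons_in_C_set_iff)
        then show ?thesis
          using r(1) Cons by (auto simp: Cons_in_C_set_iff)
      qed simp
      moreover have "sublist [2, 2, 2] r"
        using sub by (simp add: sublist_Cons_right)
      ultimately have "prefix [2, 2, 2] r"
        using sublist_replicate_least[of r 2 3] C_set_sorted[OF r(1)]
        by (simp add: numeral_3_eq_3)
      then show ?thesis
        using r(2) by (auto simp: Cons_prefix_iff)
    qed
  qed
  ultimately show "ps \<in> P7"
    using ps by (simp add: P7_def)
qed (auto simp: P7_def)

section \<open>Splitting off the parts equal to 1\<close>

definition C_set_no_111 :: "nat list set" where
  "C_set_no_111 = {ps \<in> C_set. \<not> prefix [1, 1, 1] ps}"

text \<open>All later parts are at least 2, so only 1+2+2 and 1+3+3+3 can begin at the leading 1.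
  Their tails, lowered by one, are the blocks 1+1 and 2+2+2 excluded from P_7.\<close>

lemma C_set_Cons_1_iff:
  assumes "0 \<notin> set ps"
  shows "1 # map Suc ps \<in> C_set \<longleftrightarrow> ps \<in> P7"
proof -
  have "\<not> prefix (1 # xs) (map Suc ps)" for xs
    using assms by (auto simp: Cons_prefix_iff map_eq_Cons_conv)
  moreover have "prefix [2, 2] (map Suc ps) \<longleftrightarrow> prefix [1, 1] ps"
    "prefix [3, 3, 3] (map Suc ps) \<longleftrightarrow> prefix [2, 2, 2] ps"
    using prefix_map_Suc[of "[1, 1]"] prefix_map_Suc[of "[2, 2, 2]"]
    by (simp_all add: numeral_2_eq_2 numeral_3_eq_3)
  ultimately show ?thesis
    using map_Suc_in_C_set_iff[OF assms]
    by (auto simp: Cons_in_C_set_iff P7_iff_prefix numeral_2_eq_2 numeral_3_eq_3)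
qed

text \<open>All later parts are at least 3, so only 1+3+3+3 can begin at one of the two 1s. Its
  tail, lowered by two, is 1+1+1.\<close>

lemma C_set_Cons_1_1_iff:
  assumes "0 \<notin> set ps"
  shows "1 # 1 # map Suc (map Suc ps) \<in> C_set \<longleftrightarrow> ps \<in> C_set_no_111"
proof -
  have "\<not> prefix (1 # xs) (map Suc (map Suc ps))" "\<not> prefix (2 # xs) (map Suc (map Suc ps))" for xs
    using assms by (auto simp: Cons_prefix_iff map_eq_Cons_conv)
  moreover have "prefix [3, 3, 3] (map Suc (map Suc ps)) \<longleftrightarrow> prefix [1, 1, 1] ps"
    using prefix_map_Suc[of "[1, 1, 1]" ps] prefix_map_Suc[of "[2, 2, 2]" "map Suc ps"]
    by (simp add: numeral_2_eq_2 numeral_3_eq_3)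
  moreover have "map Suc (map Suc ps) \<in> C_set \<longleftrightarrow> ps \<in> C_set"
    using assms by (subst map_Suc_in_C_set_iff; auto simp: map_Suc_in_C_set_iff simp del: map_map)
  ultimately show ?thesis
    by (auto simp: Cons_in_C_set_iff C_set_no_111_def numeral_2_eq_2 numeral_3_eq_3 simp del: map_map)
qed

text \<open>A forbidden pattern spans a difference of at most 2, so none contains both a 1 and a
  part that is at least 4.\<close>

lemma C_set_Cons_1_1_1_iff:
  assumes "0 \<notin> set ps"
  shows "1 # 1 # 1 # map Suc (map Suc (map Suc ps)) \<in> C_set \<longleftrightarrow> ps \<in> C_set"
proof -
  let ?r = "map Suc (map Suc (map Suc ps))"
  have "\<not> prefix (1 # xs) ?r" "\<not> prefix (2 # xs) ?r" "\<not> prefix (3 # xs) ?r" for xs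
    using assms by (auto simp: Cons_prefix_iff map_eq_Cons_conv)
  moreover have "?r \<in> C_set \<longleftrightarrow> ps \<in> C_set"
    using assms by (subst map_Suc_in_C_set_iff; (subst map_Suc_in_C_set_iff)?; auto simp: map_Suc_in_C_set_iff simp del: map_map)
  ultimately show ?thesis
    by (auto simp: Cons_in_C_set_iff numeral_2_eq_2 numeral_3_eq_3 simp del: map_map)
qed

lemma C_set_least:
  assumes "ps \<in> C_set" "\<And>b s. ps = b # s \<Longrightarrow> m \<le> b"
  shows "\<forall>p\<in>set ps. m \<le> p"
  using assms by (cases ps) (auto simp: Cons_in_C_set_iff intro: order_trans)

lemma C_set_start:
  assumes "ps \<in> C_set" "\<not> (\<forall>p\<in>set ps. 2 \<le> p)"
  obtains s where "ps = 1 # s" "s \<in> C_set"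
proof (cases ps)
  case (Cons b s)
  with assms have "b < 2" "0 < b" "s \<in> C_set"
    by (auto simp: Cons_in_C_set_iff)
  then show thesis
    using that[of s] Cons by simp
qed (use assms in simp)

text \<open>The cases are the possible numbers of 1s. The amount by which the rest can be lowered
  comes from the patterns with i = 1, which keep the next part away from 2 or 3.\<close>

lemma C_set_cases:
  assumes "ps \<in> C_set"
  obtains (none) r where "ps = map Suc r" "r \<in> C_set"
    | (one) r where "ps = 1 # map Suc r" "r \<in> P7"
    | (two) r where "ps = 1 # 1 # map Suc (map Suc r)" "r \<in> C_set_no_111"
    | (three) r where "ps = 1 # 1 # 1 # map Suc (map Suc (map Suc r))" "r \<in> C_set"
proof -
  \<comment> \<open>All entries are positive here, so truncated subtraction loses nothing.\<close>
  have shift: "\<exists>ps. r = map Suc ps \<and> (\<forall>p\<in>set ps. m \<le> p)" if "\<forall>p\<in>set r. Suc m \<le> p" for r m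
  proof (intro exI conjI)
    show "r = map Suc (map (\<lambda>p. p - 1) r)"
      using that by (induction r) auto
    show "\<forall>p\<in>set (map (\<lambda>p. p - 1) r). m \<le> p"
      using that by auto
  qed
  show thesis
  proof (cases "\<forall>p\<in>set ps. 2 \<le> p")
    case True
    then obtain r where r: "ps = map Suc r" "\<forall>p\<in>set r. 1 \<le> p"
      using shift[of ps 1] by (auto simp: numeral_2_eq_2)
    have "0 \<notin> set r"
      using r(2) by auto
    then have "r \<in> C_set"
      using map_Suc_in_C_set_iff assms unfolding r(1) by blast
    with r(1) show thesis
      by (rule none)
  next
    case False
    then obtain s where ps: "ps = 1 # s" and s: "s \<in> C_set"
      using C_set_start[OF assms] by blast
    show thesis
    proof (cases "\<forall>p\<in>set s. 2 \<le> p")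
      case True
      then obtain r where r: "s = map Suc r" "\<forall>p\<in>set r. 1 \<le> p"
        using shift[of s 1] by (auto simp: numeral_2_eq_2)
      have "0 \<notin> set r"
        using r(2) by auto
      then have "r \<in> P7"
        using C_set_Cons_1_iff assms unfolding ps r(1) by blast
      with ps show thesis
        unfolding r(1) by (rule one)
    next
      case False
      then obtain t where "s = 1 # t" and t: "t \<in> C_set"
        using C_set_start[OF s] by blast
      then have ps: "ps = 1 # 1 # t"
        using ps by simp
      show thesis
      proof (cases "\<forall>p\<in>set t. 2 \<le> p")
        case True
        \<comment> \<open>A part 2 would complete 1+1+2.\<close>
        have "\<forall>p\<in>set t. 3 \<le> p"
        proof (rule C_set_least[OF t])
          fix b u
          assume "t = b # u"
          then show "3 \<le> b"
            using True assms ps by (cases "b = 2") (auto simp: Cons_in_C_set_iff)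
        qed
        then obtain r' where r': "t = map Suc r'" "\<forall>p\<in>set r'. 2 \<le> p"
          using shift[of t 2] by (auto simp: numeral_3_eq_3 numeral_2_eq_2)
        then obtain r where r: "r' = map Suc r" "\<forall>p\<in>set r. 1 \<le> p"
          using shift[of r' 1] by (auto simp: numeral_2_eq_2)
        have "0 \<notin> set r"
          using r(2) by auto
        then have "r \<in> C_set_no_111"
          using C_set_Cons_1_1_iff assms unfolding ps r'(1) r(1) by blast
        with ps show thesis
          unfolding r'(1) r(1) by (rule two)
      next
        case False
        then obtain u where "t = 1 # u" and u: "u \<in> C_set"
          using C_set_start[OF t] by blast
        then have ps: "ps = 1 # 1 # 1 # u"
          using ps by simp
        \<comment> \<open>Parts 1, 2 and 3 would complete 1+1+1+1, 1+1+2 and 1+1+1+3.\<close>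
        have "\<forall>p\<in>set u. 4 \<le> p"
        proof (rule C_set_least[OF u])
          fix b v
          assume v: "u = b # v"
          have "b \<noteq> 0" "b \<noteq> 1" "b \<noteq> 2" "b \<noteq> 3"
            using assms v ps by (auto simp: Cons_in_C_set_iff numeral_2_eq_2 numeral_3_eq_3)
          then show "4 \<le> b"
            by linarith
        qed
        then obtain r'' where r'': "u = map Suc r''" "\<forall>p\<in>set r''. 3 \<le> p"
          using shift[of u 3] by auto
        then obtain r' where r': "r'' = map Suc r'" "\<forall>p\<in>set r'. 2 \<le> p"
          using shift[of r'' 2] by auto
        then obtain r where r: "r' = map Suc r" "\<forall>p\<in>set r. 1 \<le> p"
          using shift[of r' 1] by (auto simp: numeral_2_eq_2)
        have "0 \<notin> set r"
          using r(2) by auto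
        then have "r \<in> C_set"
          using C_set_Cons_1_1_1_iff assms unfolding ps r''(1) r'(1) r(1) by blast
        with ps show thesis
          unfolding r''(1) r'(1) r(1) by (rule three)
      qed
    qed
  qed
qed

lemma P7_subset_C_set: "P7 \<subseteq> C_set"
  by (auto simp: P7_def)

lemma C_set_no_111_subset_C_set: "C_set_no_111 \<subseteq> C_set"
  by (auto simp: C_set_no_111_def)

text \<open>The recursion behind the equation for A: behind 1+1+1, lowered by three, any member of C
  may follow.\<close>

lemma C_set_eq_no_111_Un:
  "C_set = C_set_no_111 \<union> (#) 1 ` (#) 1 ` (#) 1 ` map Suc ` map Suc ` map Suc ` C_set"
  (is "_ = _ \<union> ?T")
proof (intro equalityI subsetI)
  fix ps assume ps: "ps \<in> C_set"
  show "ps \<in> C_set_no_111 \<union> ?T"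
  proof (cases "prefix [1, 1, 1] ps")
    case True
    from ps show ?thesis
    proof (cases rule: C_set_cases)
      case (none r)
      with True C_set_positive[of r] show ?thesis
        by (auto simp: Cons_prefix_iff map_eq_Cons_conv)
    next
      case (one r)
      with True C_set_positive[of r] P7_subset_C_set show ?thesis
        by (auto simp: Cons_prefix_iff map_eq_Cons_conv)
    next
      case (two r)
      with True C_set_positive[of r] C_set_no_111_subset_C_set show ?thesis
        by (auto simp: Cons_prefix_iff map_eq_Cons_conv)
    next
      case (three r)
      then show ?thesis
        by (auto simp del: map_map)
    qed
  qed (use ps in \<open>auto simp: C_set_no_111_def\<close>)
next
  fix ps assume "ps \<in> C_set_no_111 \<union> ?T"
  then show "ps \<in> C_set"
    using C_set_Cons_1_1_1_iff C_set_positive C_set_no_111_subset_C_set by (auto simp: image_image)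
qed

text \<open>The recursion behind the equation for B; the three sets have no, one and two parts equal
  to 1.\<close>

lemma C_set_no_111_recursion:
  "C_set_no_111 = map Suc ` C_set \<union> ((#) 1 ` map Suc ` P7 \<union> (#) 1 ` (#) 1 ` map Suc ` map Suc ` C_set_no_111)"
  (is "_ = ?R")
proof (intro equalityI subsetI)
  fix ps assume ps: "ps \<in> C_set_no_111"
  then have "ps \<in> C_set"
    using C_set_no_111_subset_C_set by auto
  then show "ps \<in> ?R"
  proof (cases rule: C_set_cases)
    case (three r)
    then show ?thesis
      using ps by (simp add: C_set_no_111_def)
  qed (auto simp: image_image)
next
  fix ps assume "ps \<in> ?R"
  then consider r where "ps = map Suc r" "r \<in> C_set" | r where "ps = 1 # map Suc r" "r \<in> P7"
    | r where "ps = 1 # 1 # map Suc (map Suc r)" "r \<in> C_set_no_111"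
    by auto
  then show "ps \<in> C_set_no_111"
  proof cases
    case (1 r)
    then show ?thesis
      using map_Suc_in_C_set_iff[of r] C_set_positive[of r]
      by (auto simp: C_set_no_111_def Cons_prefix_iff map_eq_Cons_conv)
  next
    case (2 r)
    then show ?thesis
      using C_set_Cons_1_iff[of r] C_set_positive[of r] P7_subset_C_set
      by (auto simp: C_set_no_111_def Cons_prefix_iff map_eq_Cons_conv)
  next
    case (3 r)
    then show ?thesis
      using C_set_Cons_1_1_iff[of r] C_set_positive[of r] C_set_no_111_subset_C_set
      by (auto simp: C_set_no_111_def Cons_prefix_iff map_eq_Cons_conv)
  qed
qed

lemma map_Suc_in_P7_iff:
  assumes "0 \<notin> set r"
  shows "map Suc r \<in> P7 \<longleftrightarrow> r \<in> C_set_no_111"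
proof -
  have "\<not> prefix [1, 1] (map Suc r)"
    using assms by (auto simp: Cons_prefix_iff map_eq_Cons_conv)
  moreover have "prefix [2, 2, 2] (map Suc r) \<longleftrightarrow> prefix [1, 1, 1] r"
    using prefix_map_Suc[of "[1, 1, 1]" r] by (simp add: numeral_2_eq_2)
  ultimately show ?thesis
    using map_Suc_in_C_set_iff[OF assms] by (simp add: P7_iff_prefix C_set_no_111_def)
qed

text \<open>The recursion behind the equation for D. Without a 1, lowering turns 2+2+2 into 1+1+1.
  With a single 1 in front, membership in C already forces the lowered rest into P_7, and neither
  1+1 nor 2+2+2 can be a prefix.\<close>

lemma P7_recursion: "P7 = map Suc ` C_set_no_111 \<union> (#) 1 ` map Suc ` P7"
  (is "_ = ?R")
proof (intro equalityI subsetI)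
  fix ps assume ps: "ps \<in> P7"
  then have "ps \<in> C_set"
    using P7_subset_C_set by auto
  then show "ps \<in> ?R"
  proof (cases rule: C_set_cases)
    case (none r)
    then show ?thesis
      using ps map_Suc_in_P7_iff[of r] C_set_positive[of r] by auto
  qed (use ps in \<open>auto simp: image_image P7_iff_prefix\<close>)
next
  fix ps assume "ps \<in> ?R"
  then consider r where "ps = map Suc r" "r \<in> C_set_no_111" | r where "ps = 1 # map Suc r" "r \<in> P7"
    by auto
  then show "ps \<in> P7"
  proof cases
    case (1 r)
    then show ?thesis
      using map_Suc_in_P7_iff[of r] C_set_positive[of r] C_set_no_111_subset_C_set by auto
  next
    case (2 r)
    then show ?thesis
      using C_set_Cons_1_iff[of r] C_set_positive[of r] P7_subset_C_set
      by (auto simp: P7_iff_prefix Cons_prefix_iff map_eq_Cons_conv)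
  qed
qed

lemma P7a_eq: "P7a = map Suc ` map Suc ` C_set"
proof (intro equalityI subsetI)
  fix ps assume "ps \<in> P7a"
  then have ps: "ps \<in> C_set" "\<forall>p\<in>set ps. 3 \<le> p"
    by (auto simp: P7a_def)
  let ?r = "map (\<lambda>p. p - 2) ps"
  have r: "ps = map Suc (map Suc ?r)"
    using ps(2) by (induction ps) auto
  have "0 \<notin> set ?r"
    using ps(2) by fastforce
  then have "map Suc (map Suc ?r) \<in> C_set \<longleftrightarrow> ?r \<in> C_set"
    by (subst map_Suc_in_C_set_iff) (auto simp: map_Suc_in_C_set_iff simp del: map_map)
  with ps(1) r have "?r \<in> C_set"
    by simp
  with r show "ps \<in> map Suc ` map Suc ` C_set"
    by blast
next
  fix ps assume "ps \<in> map Suc ` map Suc ` C_set"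
  then obtain r where r: "ps = map Suc (map Suc r)" "r \<in> C_set"
    by auto
  have "0 \<notin> set r"
    by (rule C_set_positive) fact
  then have "map Suc (map Suc r) \<in> C_set \<longleftrightarrow> r \<in> C_set"
    by (subst map_Suc_in_C_set_iff) (auto simp: map_Suc_in_C_set_iff simp del: map_map)
  then show "ps \<in> P7a"
    using r \<open>0 \<notin> set r\<close> by (auto simp: P7a_def numeral_3_eq_3 Suc_le_eq intro: gr0I)
qed

text \<open>The set recursions become functional equations, since the united sets differ in their
  leading 1s and are therefore disjoint.\<close>

lemma qdiff_system_list_gf: "qdiff_system (list_gf C_set) (list_gf P7)"
proof -
  let ?A = "list_gf C_set" and ?B = "list_gf C_set_no_111" and ?D = "list_gf P7"
  have map_Cons: "map Suc ` S \<inter> (#) 1 ` T = {}" if "S \<subseteq> C_set" for S T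
    using that C_set_positive by (fastforce simp: map_eq_Cons_conv)
  have A: "?A = ?B + qvar * (fps_X * (qvar * (fps_X * (qvar * (fps_X * qshift (qshift (qshift ?A)))))))"
  proof -
    have "C_set_no_111 \<inter> (#) 1 ` (#) 1 ` (#) 1 ` map Suc ` map Suc ` map Suc ` C_set = {}"
      by (auto simp: C_set_no_111_def)
    then show ?thesis
      by (subst C_set_eq_no_111_Un) (simp add: list_gf_Un list_gf_Cons_1 list_gf_map_Suc del: One_nat_def)
  qed
  have B: "?B = qshift ?A + (qvar * (fps_X * qshift ?D) +
      qvar * (fps_X * (qvar * (fps_X * qshift (qshift ?B)))))"
  proof -
    have 1: "map Suc ` C_set \<inter> ((#) 1 ` map Suc ` P7 \<union> (#) 1 ` (#) 1 ` map Suc ` map Suc ` C_set_no_111) = {}"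
      using map_Cons[of C_set] by (simp add: Int_Un_distrib)
    have 2: "(#) 1 ` map Suc ` P7 \<inter> (#) 1 ` (#) 1 ` map Suc ` map Suc ` C_set_no_111 = {}"
      using map_Cons[OF P7_subset_C_set, of "map Suc ` map Suc ` C_set_no_111"]
      by (simp add: inj_on_Un_image_eq_iff flip: image_Int)
    show ?thesis
      by (subst C_set_no_111_recursion)
        (simp add: list_gf_Un 1 2 list_gf_Cons_1 list_gf_map_Suc del: One_nat_def)
  qed
  have D: "?D = qshift ?B + qvar * (fps_X * qshift ?D)"
    by (subst P7_recursion) (simp add: list_gf_Un map_Cons[OF C_set_no_111_subset_C_set]
        list_gf_Cons_1 list_gf_map_Suc del: One_nat_def)
  \<comment> \<open>Solving for B eliminates it from the other two equations. The term q^11 x^5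
    comes from q^2 x^2 B(x q^2), where q^3 x^3 has become q^9 x^3.\<close>
  have B': "?B = ?A - qvar ^ 3 * (fps_X ^ 3 * qshift (qshift (qshift ?A)))"
    using A by algebra
  have "{ps \<in> C_set. length ps = 0 \<and> sum_list ps = N} = (if N = 0 then {[]} else {})" for N
    using Nil_in_C_set by auto
  then have "fps_nth ?A 0 = 1"
    by (intro fps_ext) (auto simp: list_gf_nth)
  moreover have "?D = qvar * (fps_X * qshift ?D) + qshift ?A
       - qvar ^ 6 * (fps_X ^ 3 * qshift (qshift (qshift (qshift ?A))))"
    using D arg_cong[OF B', of qshift] unfolding qshift_simps by algebra
  moreover have "?A = qshift ?A + qvar * (fps_X * qshift ?D)
       + qvar ^ 2 * (fps_X ^ 2 * qshift (qshift ?A))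
       - qvar ^ 11 * (fps_X ^ 5 * qshift (qshift (qshift (qshift (qshift ?A)))))
       + qvar ^ 3 * (fps_X ^ 3 * qshift (qshift (qshift ?A)))"
    using A B arg_cong[OF arg_cong[OF B', of qshift], of qshift] unfolding qshift_simps by algebra
  ultimately show ?thesis
    by (simp add: qdiff_system_def)
qed

lemma list_gf_C_set: "list_gf C_set = triangular product_A"
  and list_gf_P7: "list_gf P7 = triangular product_D"
  using qdiff_system_unique[OF qdiff_system_list_gf qdiff_system_product] .

lemma list_gf_P7a: "list_gf P7a = triangular (qshift (qshift product_A))"
  by (simp add: P7a_eq list_gf_map_Suc list_gf_C_set triangular_qshift)

section \<open>Infinite sums in the order of variables of the theorem\<close>

text \<open>In the q-adic topology it suffices that each coefficient of the partial sums becomes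
  constant. This happens once the finitely many contributing indices are included.\<close>

lemma has_sum_fpsI:
  fixes f :: "'b \<Rightarrow> 'a :: comm_ring_1 fps"
  assumes "\<And>N. finite {t \<in> A. fps_nth (f t) N \<noteq> 0}"
    and "\<And>N. fps_nth S N = (\<Sum>t | t \<in> A \<and> fps_nth (f t) N \<noteq> 0. fps_nth (f t) N)"
  shows "(f has_sum S) A"
  unfolding has_sum_def
proof (rule tendsto_fpsI)
  fix N
  let ?T = "{t \<in> A. fps_nth (f t) N \<noteq> 0}"
  show "\<forall>\<^sub>F F in finite_subsets_at_top A. fps_nth (sum f F) N = fps_nth S N"
    unfolding eventually_finite_subsets_at_top
  proof (intro exI[of _ ?T] conjI allI impI)
    fix F
    assume F: "finite F \<and> ?T \<subseteq> F \<and> F \<subseteq> A"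
    then have "(\<Sum>t\<in>F. fps_nth (f t) N) = (\<Sum>t\<in>?T. fps_nth (f t) N)"
      by (intro sum.mono_neutral_right) auto
    then show "fps_nth (sum f F) N = fps_nth S N"
      by (simp add: fps_sum_nth assms(2))
  qed (use assms(1) in auto)
qed

text \<open>Exchanges the nesting of x and q, passing to the ring in which the sums of the theorem
  converge.\<close>

definition transpose_fps :: "'a :: zero fps fps \<Rightarrow> 'a fps fps" where
  "transpose_fps f = Abs_fps (\<lambda>N. Abs_fps (\<lambda>n. fps_nth (fps_nth f n) N))"

lemma transpose_fps_nth: "fps_nth (fps_nth (transpose_fps f) N) n = fps_nth (fps_nth f n) N"
  by (simp add: transpose_fps_def)

text \<open>The embedding of series in q alone, with coefficients constant in x.\<close>

definition lift_Q :: "rat fps \<Rightarrow> xq_series" where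
  "lift_Q f = Abs_fps (\<lambda>N. fps_const (fps_nth f N))"

lemma lift_Q_nth: "fps_nth (lift_Q f) N = fps_const (fps_nth f N)"
  by (simp add: lift_Q_def)

lemma lift_Q_1: "lift_Q 1 = 1"
  by (rule fps_ext) (simp add: lift_Q_nth)

lemma lift_Q_fps_X: "lift_Q fps_X = Q"
  by (rule fps_ext) (simp add: lift_Q_nth Q_def fps_X_def)

lemma lift_Q_diff: "lift_Q (f - g) = lift_Q f - lift_Q g"
  by (rule fps_ext) (simp add: lift_Q_nth)

lemma lift_Q_uminus: "lift_Q (- f) = - lift_Q f"
  by (rule fps_ext) (simp add: lift_Q_nth)

lemma fps_const_sum: "fps_const (sum f A) = (\<Sum>x\<in>A. fps_const (f x))"
  by (induction A rule: infinite_finite_induct) (simp_all flip: fps_const_add)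

lemma lift_Q_mult: "lift_Q (f * g) = lift_Q f * lift_Q g"
  by (rule fps_ext) (simp add: lift_Q_nth fps_mult_nth fps_const_sum)

lemma lift_Q_power: "lift_Q (f ^ n) = lift_Q f ^ n"
  by (induction n) (simp_all add: lift_Q_1 lift_Q_mult)

lemma lift_Q_rqpoch: "lift_Q (rqpoch r n) = qpoch (Q ^ r) (Q ^ r) n"
  by (induction n)
    (simp_all add: rqpoch_def qpoch_def lift_Q_1 lift_Q_mult lift_Q_diff lift_Q_power lift_Q_fps_X)

lemma X_power_mult_lift_Q_nth:
  "fps_nth (fps_nth (X ^ m * lift_Q f) N) n = (if n = m then fps_nth f N else 0)"
  by (simp add: X_def fps_const_power lift_Q_nth)

text \<open>Finiteness for each power of q gives convergence; finiteness for each power of x makes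
  the coefficients of \<open>f\<close> genuine finite sums. Both orders of summation then agree
  coefficientwise.\<close>

lemma has_sum_transpose_fps:
  assumes fin: "\<And>N. finite {t. fps_nth (v t) N \<noteq> 0}" "\<And>n. finite {t. w t = n}"
    and nth: "\<And>n. fps_nth f n = (\<Sum>t | w t = n. v t)"
  shows "((\<lambda>t. X ^ w t * lift_Q (v t)) has_sum transpose_fps f) UNIV"
proof (rule has_sum_fpsI)
  have eq: "{t \<in> UNIV. fps_nth (X ^ w t * lift_Q (v t)) N \<noteq> 0} = {t. fps_nth (v t) N \<noteq> 0}" for N
    by (auto simp: fps_eq_iff X_power_mult_lift_Q_nth)
  fix N
  show "finite {t \<in> UNIV. fps_nth (X ^ w t * lift_Q (v t)) N \<noteq> 0}"
    unfolding eq by (rule fin(1))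
  show "fps_nth (transpose_fps f) N =
      (\<Sum>t | t \<in> UNIV \<and> fps_nth (X ^ w t * lift_Q (v t)) N \<noteq> 0. fps_nth (X ^ w t * lift_Q (v t)) N)"
    unfolding eq
  proof (rule fps_ext)
    fix n
    have "(\<Sum>t | w t = n. fps_nth (v t) N) = (\<Sum>t | w t = n \<and> fps_nth (v t) N \<noteq> 0. fps_nth (v t) N)"
      using fin(2)[of n] by (intro sum.mono_neutral_right) auto
    also have "\<dots> = (\<Sum>t | fps_nth (v t) N \<noteq> 0. if n = w t then fps_nth (v t) N else 0)"
      using fin(1)[of N] by (intro sum.mono_neutral_cong_left) auto
    finally show "fps_nth (fps_nth (transpose_fps f) N) n =
        fps_nth (\<Sum>t | fps_nth (v t) N \<noteq> 0. fps_nth (X ^ w t * lift_Q (v t)) N) n"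
      by (simp add: transpose_fps_nth nth fps_sum_nth X_power_mult_lift_Q_nth)
  qed
qed

text \<open>Parts are positive, so the length is at most the sum and each N has only finitely many
  partitions.\<close>

lemma has_sum_list_gf:
  assumes "S \<subseteq> C_set"
  shows "((\<lambda>ps. X ^ length ps * Q ^ sum_list ps) has_sum transpose_fps (list_gf S)) S"
proof (rule has_sum_fpsI)
  fix N
  have eq: "{ps \<in> S. fps_nth (X ^ length ps * Q ^ sum_list ps) N \<noteq> 0} = {ps \<in> S. sum_list ps = N}"
    by (auto simp: fps_eq_iff X_Q_nth)
  have "length ps \<le> sum_list ps" if "0 \<notin> set ps" for ps :: "nat list"
    using that by (induction ps) auto
  then have "{ps \<in> S. sum_list ps = N} \<subseteq> (\<Union>n\<le>N. {ps \<in> S. length ps = n \<and> sum_list ps = N})"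
    using assms C_set_positive by auto
  then have fin: "finite {ps \<in> S. sum_list ps = N}"
    by (rule finite_subset) (simp add: finite_length_sum)
  then show "finite {ps \<in> S. fps_nth (X ^ length ps * Q ^ sum_list ps) N \<noteq> 0}"
    unfolding eq .
  show "fps_nth (transpose_fps (list_gf S)) N =
      (\<Sum>ps | ps \<in> S \<and> fps_nth (X ^ length ps * Q ^ sum_list ps) N \<noteq> 0.
        fps_nth (X ^ length ps * Q ^ sum_list ps) N)"
    unfolding eq
  proof (rule fps_ext)
    fix n
    have "of_nat (card {ps \<in> S. length ps = n \<and> sum_list ps = N}) =
        (\<Sum>ps | ps \<in> S \<and> length ps = n \<and> sum_list ps = N. 1 :: rat)"
      by simp
    also have "\<dots> = (\<Sum>ps | ps \<in> S \<and> sum_list ps = N. if n = length ps \<and> N = sum_list ps then 1 else 0)"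
      using fin by (intro sum.mono_neutral_cong_left) auto
    finally show "fps_nth (fps_nth (transpose_fps (list_gf S)) N) n =
        fps_nth (\<Sum>ps | ps \<in> S \<and> sum_list ps = N. fps_nth (X ^ length ps * Q ^ sum_list ps) N) n"
      by (simp only: transpose_fps_nth list_gf_nth fps_sum_nth X_Q_nth)
  qed
qed

section \<open>Products of Euler expansions as quadruple sums\<close>

lemma spread_mult_nth:
  assumes "0 < r" "\<And>n. finite {t. w t = n}" "\<And>n. fps_nth f n = (\<Sum>t | w t = n. v t)"
  shows "finite {p. (case p of (j, t) \<Rightarrow> r * j + w t) = n}"
    and "fps_nth (spread r u * f) n = (\<Sum>p | (case p of (j, t) \<Rightarrow> r * j + w t) = n. case p of (j, t) \<Rightarrow> u j * v t)"
proof -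
  let ?J = "{j. r * j \<le> n}"
  have "?J \<subseteq> {..n}"
  proof
    fix j
    assume "j \<in> ?J"
    moreover have "j \<le> r * j"
      using assms(1) by (simp add: Suc_le_eq)
    ultimately show "j \<in> {..n}"
      unfolding mem_Collect_eq atMost_iff by linarith
  qed
  then have J: "finite ?J"
    by (rule finite_subset) simp
  have eq: "{p. (case p of (j, t) \<Rightarrow> r * j + w t) = n} = (SIGMA j:?J. {t. w t = n - r * j})"
    by auto
  show "finite {p. (case p of (j, t) \<Rightarrow> r * j + w t) = n}"
    unfolding eq using J assms(2) by blast
  have "fps_nth (spread r u * f) n = (\<Sum>i = 0..n. (if r dvd i then u (i div r) else 0) * fps_nth f (n - i))"
    by (simp add: fps_mult_nth spread_nth)
  also have "\<dots> = (\<Sum>i \<in> (*) r ` ?J. u (i div r) * fps_nth f (n - i))"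
    by (rule sum.mono_neutral_cong_right) (auto elim!: dvdE)
  also have "\<dots> = (\<Sum>j \<in> ?J. u j * fps_nth f (n - r * j))"
    using assms(1) by (subst sum.reindex) (auto simp: inj_on_def)
  also have "\<dots> = (\<Sum>p | (case p of (j, t) \<Rightarrow> r * j + w t) = n. case p of (j, t) \<Rightarrow> u j * v t)"
    unfolding eq using J assms(2) by (simp add: assms(3) sum_distrib_left sum.Sigma)
  finally show "fps_nth (spread r u * f) n = (\<Sum>p | (case p of (j, t) \<Rightarrow> r * j + w t) = n. case p of (j, t) \<Rightarrow> u j * v t)" .
qed

text \<open>Starting from the index l, three uses of \<open>spread_mult_nth\<close> adjoin k, j and
  i. The weight \<open>w\<close> is kept in the nested form this produces.\<close>

lemma euler_product_nth:
  fixes c1 c2 c3 c4 n :: nat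
  defines "w \<equiv> \<lambda>(i, j, k, l). 1 * i + (2 * j + (3 * k + 4 * l))"
  defines "v \<equiv> \<lambda>(i, j, k, l). fps_X ^ (c1 * i) * inverse (rqpoch 1 i) *
      (fps_X ^ (c2 * j) * inverse (rqpoch 2 j) * (fps_X ^ (c3 * k) * inverse (rqpoch 3 k) *
      ((- 1) ^ l * fps_X ^ (4 * (l * (l - 1) div 2) + c4 * l) * inverse (rqpoch 4 l))))"
  shows "finite {t. w t = n}"
    and "fps_nth (euler_inv 1 c1 * (euler_inv 2 c2 * (euler_inv 3 c3 * euler_prod 4 c4))) n =
      (\<Sum>t | w t = n. v t)"
proof -
  have fin4: "finite {l. 4 * l = n}" for n :: nat
    by (rule finite_subset[of _ "{..n}"]) auto
  have nth4: "fps_nth (spread 4 u) n = (\<Sum>l | 4 * l = n. u l)" for u n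
  proof (cases "4 dvd n")
    case True
    then have "{l. 4 * l = n} = {n div 4}"
      by auto
    with True show ?thesis
      by (simp add: spread_nth)
  next
    case False
    then have "{l. 4 * l = n} = {}"
      by auto
    with False show ?thesis
      by (simp add: spread_nth)
  qed
  \<comment> \<open>The \<open>num\<close> arguments here and in the next line stand for the
    numerals 3 and 2.\<close>
  note s3 = spread_mult_nth[where w = "\<lambda>l. 4 * l", OF zero_less_numeral fin4 nth4, of "num.Bit1 num.One"]
  note s2 = spread_mult_nth[OF zero_less_numeral s3, of "num.Bit0 num.One"]
  note s1 = spread_mult_nth[OF zero_less_one s2]
  show "finite {t. w t = n}"
    unfolding w_def using s1(1)[of n] by (simp add: case_prod_unfold)
  show "fps_nth (euler_inv 1 c1 * (euler_inv 2 c2 * (euler_inv 3 c3 * euler_prod 4 c4))) n =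
      (\<Sum>t | w t = n. v t)"
    unfolding euler_inv_def euler_prod_def w_def v_def
    by (subst s1(2)) (simp add: case_prod_unfold)
qed

text \<open>The shift to \<open>c4 + 2\<close> absorbs the quadratic exponent: 4 l (l - 1) / 2 + (c4
  + 2) l = 2 l^2 + c4 l. Positive constants let the exponent of q bound all four indices, which
  gives convergence.\<close>

lemma euler_product_has_sum:
  fixes c1 c2 c3 c4 :: nat
  assumes "0 < c1" "0 < c2" "0 < c3" "0 < c4"
  shows "((\<lambda>(i, j, k, l). let M = i + 2 * j + 3 * k + 4 * l in
      (- 1) ^ l * (X ^ M * Q ^ (M * (M - 1) div 2 + 2 * l ^ 2 + c1 * i + c2 * j + c3 * k + c4 * l)) /
      (qpoch Q Q i * qpoch (Q ^ 2) (Q ^ 2) j * qpoch (Q ^ 3) (Q ^ 3) k * qpoch (Q ^ 4) (Q ^ 4) l))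
    has_sum transpose_fps (triangular
      (euler_inv 1 c1 * (euler_inv 2 c2 * (euler_inv 3 c3 * euler_prod 4 (c4 + 2)))))) UNIV"
    (is "(?f has_sum transpose_fps (triangular ?p)) UNIV")
proof -
  define w where "w = (\<lambda>(i, j, k, l). 1 * i + (2 * j + (3 * k + 4 * l)) :: nat)"
  define v where "v = (\<lambda>(i, j, k, l). fps_X ^ (c1 * i) * inverse (rqpoch 1 i) *
      (fps_X ^ (c2 * j) * inverse (rqpoch 2 j) * (fps_X ^ (c3 * k) * inverse (rqpoch 3 k) *
      ((- 1) ^ l * fps_X ^ (4 * (l * (l - 1) div 2) + (c4 + 2) * l) * inverse (rqpoch 4 l)))))"
  define e where "e = (\<lambda>(i, j, k, l). let M = i + 2 * j + 3 * k + 4 * l in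
      M * (M - 1) div 2 + 2 * l ^ 2 + c1 * i + c2 * j + c3 * k + c4 * l)"
  define r where "r = (\<lambda>(i, j, k, l). rqpoch 1 i * rqpoch 2 j * rqpoch 3 k * rqpoch 4 l)"
  define s where "s = (\<lambda>(i :: nat, j :: nat, k :: nat, l :: nat). (- 1) ^ l :: rat fps)"
  define u where "u = (\<lambda>t. fps_X ^ (w t * (w t - 1) div 2) * v t)"
  \<comment> \<open>The summand with its denominator cleared: sign times a power of q.\<close>
  have u: "u t * r t = s t * fps_X ^ e t" for t
  proof -
    obtain i j k l where t: "t = (i, j, k, l)"
      by (cases t)
    have l: "4 * (l * (l - 1) div 2) + (c4 + 2) * l = 2 * l ^ 2 + c4 * l"
    proof -
      have "2 * (l * (l - 1) div 2) = l * (l - 1)"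
        by (rule dvd_mult_div_cancel) (cases l; simp)
      moreover have "l * (l - 1) + l = l ^ 2"
        by (cases l) (auto simp: power2_eq_square)
      moreover have "4 * d + (c4 + 2) * l = 2 * (2 * d + l) + c4 * l" for d
        by (simp add: algebra_simps)
      ultimately show ?thesis
        by presburger
    qed
    have w: "w t = i + 2 * j + 3 * k + 4 * l"
      by (simp add: w_def t)
    have "u t * r t = s t * (fps_X ^ (w t * (w t - 1) div 2) * fps_X ^ (c1 * i) * fps_X ^ (c2 * j) *
        fps_X ^ (c3 * k) * fps_X ^ (2 * l ^ 2 + c4 * l)) *
        (inverse (rqpoch 1 i) * rqpoch 1 i) * (inverse (rqpoch 2 j) * rqpoch 2 j) *
        (inverse (rqpoch 3 k) * rqpoch 3 k) * (inverse (rqpoch 4 l) * rqpoch 4 l)"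
      unfolding u_def v_def r_def s_def t prod.case l by (simp only: ac_simps)
    also have "\<dots> = s t * fps_X ^ e t"
      unfolding inverse_rqpoch_mult[OF zero_less_one] inverse_rqpoch_mult[OF zero_less_numeral] mult_1_right w
      by (simp add: e_def t Let_def add.assoc flip: power_add)
    finally show ?thesis .
  qed
  have fin: "finite {t. w t = n}" for n
    unfolding w_def by (rule euler_product_nth(1))
  have "fps_nth (triangular ?p) n = (\<Sum>t | w t = n. u t)" for n
  proof -
    have "fps_nth ?p n = (\<Sum>t | w t = n. v t)"
      unfolding w_def v_def by (rule euler_product_nth(2))
    then show ?thesis
      by (simp add: u_def sum_distrib_left)
  qed
  moreover have "finite {t. fps_nth (u t) N \<noteq> 0}" for N
  proof (rule finite_subset)
    show "{t. fps_nth (u t) N \<noteq> 0} \<subseteq> {..N} \<times> {..N} \<times> {..N} \<times> {..N}"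
    proof
      fix t
      assume t: "t \<in> {t. fps_nth (u t) N \<noteq> 0}"
      obtain i j k l where ijkl: "t = (i, j, k, l)"
        by (cases t)
      have "inverse (r t) * r t = 1"
        by (rule inverse_mult_eq_1) (simp add: r_def ijkl rqpoch_nth_0)
      then have "u t = u t * (inverse (r t) * r t)"
        by simp
      also have "\<dots> = u t * r t * inverse (r t)"
        by (simp only: ac_simps)
      finally have "u t = fps_X ^ e t * (s t * inverse (r t))"
        unfolding u by (simp only: ac_simps)
      then have "e t \<le> N"
        using t by (auto simp: fps_X_power_mult_nth split: if_splits)
      moreover have "i \<le> c1 * i" "j \<le> c2 * j" "k \<le> c3 * k" "l \<le> c4 * l"
        using assms by (simp_all add: Suc_le_eq)
      ultimately have "i \<le> N" "j \<le> N" "k \<le> N" "l \<le> N"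
        unfolding ijkl e_def Let_def prod.case by linarith+
      then show "t \<in> {..N} \<times> {..N} \<times> {..N} \<times> {..N}"
        by (simp add: ijkl)
    qed
  qed simp
  ultimately have "((\<lambda>t. X ^ w t * lift_Q (u t)) has_sum transpose_fps (triangular ?p)) UNIV"
    using fin by (intro has_sum_transpose_fps) auto
  moreover have "X ^ w t * lift_Q (u t) = ?f t" for t
  proof -
    obtain i j k l where t: "t = (i, j, k, l)"
      by (cases t)
    let ?M = "i + 2 * j + 3 * k + 4 * l"
    let ?num = "(- 1) ^ l * (X ^ ?M * Q ^ (?M * (?M - 1) div 2 + 2 * l ^ 2 + c1 * i + c2 * j + c3 * k + c4 * l))"
    let ?den = "qpoch Q Q i * qpoch (Q ^ 2) (Q ^ 2) j * qpoch (Q ^ 3) (Q ^ 3) k * qpoch (Q ^ 4) (Q ^ 4) l"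
    have den_0: "fps_nth ?den 0 = 1"
      using qpoch_Q_nth_0[of 1 1] by (simp add: qpoch_Q_nth_0)
    have den: "?den = lift_Q (r t)"
      by (simp add: r_def t lift_Q_mult lift_Q_rqpoch)
    \<comment> \<open>Both sides are compared after multiplication by the denominator, which has
      constant coefficient 1 and can be cancelled.\<close>
    have "X ^ w t * lift_Q (u t) * ?den = X ^ w t * lift_Q (u t * r t)"
      unfolding den by (simp only: lift_Q_mult mult.assoc)
    also have "\<dots> = ?num"
      unfolding u
      by (simp add: w_def s_def e_def t lift_Q_mult lift_Q_power lift_Q_uminus lift_Q_1 lift_Q_fps_X Let_def ac_simps)
    also have "\<dots> = ?num / ?den * ?den"
      by (rule xq_divide_mult_cancel[symmetric]) (rule den_0)
    finally have "X ^ w t * lift_Q (u t) = ?num / ?den"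
      using den_0 by (metis fps_zero_nth mult_right_cancel zero_neq_one)
    then show ?thesis
      by (simp only: t prod.case Let_def)
  qed
  ultimately show ?thesis
    by simp
qed

theorem mainTheorem10:
  shows "(\<exists>S. ((\<lambda>ps. X ^ length ps * Q ^ sum_list ps) has_sum S) P7 \<and>
    ((\<lambda>(i, j, k, l). let M = i + 2 * j + 3 * k + 4 * l in
      (- 1) ^ l * (X ^ M * Q ^ (M * (M - 1) div 2 + 2 * l ^ 2 + i + 3 * j + 6 * k + 6 * l)) /
      (qpoch Q Q i * qpoch (Q ^ 2) (Q ^ 2) j * qpoch (Q ^ 3) (Q ^ 3) k * qpoch (Q ^ 4) (Q ^ 4) l))
     has_sum S) UNIV) \<and>
    (\<exists>S. ((\<lambda>ps. X ^ length ps * Q ^ sum_list ps) has_sum S) P7a \<and>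
    ((\<lambda>(i, j, k, l). let M = i + 2 * j + 3 * k + 4 * l in
      (- 1) ^ l * (X ^ M * Q ^ (M * (M - 1) div 2 + 2 * l ^ 2 + 3 * i + 5 * j + 6 * k + 10 * l)) /
      (qpoch Q Q i * qpoch (Q ^ 2) (Q ^ 2) j * qpoch (Q ^ 3) (Q ^ 3) k * qpoch (Q ^ 4) (Q ^ 4) l))
     has_sum S) UNIV)"
proof (intro conjI exI)
  show "((\<lambda>ps. X ^ length ps * Q ^ sum_list ps) has_sum transpose_fps (list_gf P7)) P7"
    by (rule has_sum_list_gf) (rule P7_subset_C_set)
  show "((\<lambda>(i, j, k, l). let M = i + 2 * j + 3 * k + 4 * l in
      (- 1) ^ l * (X ^ M * Q ^ (M * (M - 1) div 2 + 2 * l ^ 2 + i + 3 * j + 6 * k + 6 * l)) /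
      (qpoch Q Q i * qpoch (Q ^ 2) (Q ^ 2) j * qpoch (Q ^ 3) (Q ^ 3) k * qpoch (Q ^ 4) (Q ^ 4) l))
     has_sum transpose_fps (list_gf P7)) UNIV"
    \<comment> \<open>The last constant is 6 because H contains (x^4 q^8; q^4) and 8 = 6 +
      2.\<close>
    using euler_product_has_sum[of 1 3 6 6] unfolding list_gf_P7 product_D_def by simp
  show "((\<lambda>ps. X ^ length ps * Q ^ sum_list ps) has_sum transpose_fps (list_gf P7a)) P7a"
    by (rule has_sum_list_gf) (auto simp: P7a_def)
  \<comment> \<open>Two shifts raise the constants 1, 1, 0, 4 of K by 2, 4, 6, 8; the last one is 12
    = 10 + 2.\<close>
  have "qshift (qshift product_A) =
      euler_inv 1 3 * (euler_inv 2 5 * (euler_inv 3 6 * euler_prod 4 (10 + 2)))"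
    by (simp add: product_A_def qshift_mult qshift_euler_inv qshift_euler_prod eval_nat_numeral)
  then show "((\<lambda>(i, j, k, l). let M = i + 2 * j + 3 * k + 4 * l in
      (- 1) ^ l * (X ^ M * Q ^ (M * (M - 1) div 2 + 2 * l ^ 2 + 3 * i + 5 * j + 6 * k + 10 * l)) /
      (qpoch Q Q i * qpoch (Q ^ 2) (Q ^ 2) j * qpoch (Q ^ 3) (Q ^ 3) k * qpoch (Q ^ 4) (Q ^ 4) l))
     has_sum transpose_fps (list_gf P7a)) UNIV"
    using euler_product_has_sum[of 3 5 6 10] unfolding list_gf_P7a by simp
qed

end
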